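(* For all $m,l\in\mathbb{C}$ and every integer $n\ge 0$, the following identity of polynomials in the two variables $x$ and $y$ holds: $$\sum_{k=0}^{n}\binom{n}{k}B_{k}^{(m)}(x)\,E_{n-k}^{(l-1)}(y)=\sum_{k=0}^{n}\binom{n}{k}\Big[B_{k}^{(m)}(x)+\frac{k}{2}B_{k-1}^{(m-1)}(x)\Big]E_{n-k}^{(l)}(y).$$
   Context: For $m\in\mathbb{C}$, the generalized Bernoulli polynomials $B_n^{(m)}$, $n=0,1,2,\dots$, are defined by the expansion (for $u$ near $0$, or as formal power series in $u$) $$\Big(\frac{u}{e^{u}-1}\Big)^m e^{ux}=\sum_{n=0}^{\infty}\frac{u^n}{n!}B_{n}^{(m)}(x).$$ For $l\in\mathbb{C}$, the generalized Euler polynomials $E_n^{(l)}$, $n=0,1,2,\dots$, are defined by $$\Big(\frac{2}{e^{u}+1}\Big)^l e^{ux}=\sum_{n=0}^{\infty}\frac{u^n}{n!}E_{n}^{(l)}(x).$$ Here the complex powers are the branches taking the value $1$ at $u=0$ (both $\frac{u}{e^u-1}$ and $\frac{2}{e^u+1}$ equal $1$ at $u=0$). The term $\frac{k}{2}B_{k-1}^{(m-1)}(x)$ is interpreted as $0$ when $k=0$. *)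

theory Defs
  imports "HOL-Complex_Analysis.Complex_Analysis" "HOL-Computational_Algebra.Computational_Algebra"
begin

text \<open>
  The power \<open>F\<^sup>c\<close> of a power series with constant coefficient 1, expanded by the binomial series
  in \<open>F - 1\<close>; the constant coefficient of the result is 1. This is only meaningful if
  \<^term>\<open>fps_nth F 0 = 1\<close>. Lemma \<open>has_fps_expansion_fps_cpow\<close> below shows that it is the Taylor
  series of the principal branch of the power.
\<close>
definition fps_cpow :: "complex fps \<Rightarrow> complex \<Rightarrow> complex fps" where
  "fps_cpow F c = fps_compose (fps_binomial c) (F - 1)"

text \<open>
  Power series in \<open>u\<close> with coefficients in \<open>\<complex>[x]\<close>: \<open>exp (u x)\<close>, and the
  image of a series with complex coefficients.
\<close>
definition fps_exp_ux :: "complex poly fps" where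
  "fps_exp_ux = Abs_fps (\<lambda>n. monom (1 / fact n) n)"

definition fps_lift_poly :: "complex fps \<Rightarrow> complex poly fps" where
  "fps_lift_poly F = Abs_fps (\<lambda>n. [:fps_nth F n:])"

text \<open>
  In \<open>fps_X / (fps_exp 1 - 1)\<close> both series have order 1, so this is the exact quotient, with
  constant coefficient 1 (see \<open>bernoulli_base_nth_0\<close>).
\<close>
definition gen_bernoulli_poly :: "complex \<Rightarrow> nat \<Rightarrow> complex poly" where
  "gen_bernoulli_poly m n =
     smult (fact n)
       (fps_nth (fps_lift_poly (fps_cpow (fps_X / (fps_exp 1 - 1)) m) * fps_exp_ux) n)"

definition gen_euler_poly :: "complex \<Rightarrow> nat \<Rightarrow> complex poly" where
  "gen_euler_poly l n =
     smult (fact n)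
       (fps_nth (fps_lift_poly (fps_cpow (2 / (fps_exp 1 + 1)) l) * fps_exp_ux) n)"

lemma poly_fps_nth_lift_exp:
  "poly (fps_nth (fps_lift_poly F * fps_exp_ux) n) x = fps_nth (F * fps_exp x) n"
  by (simp add: fps_mult_nth fps_lift_poly_def fps_exp_ux_def poly_sum poly_monom)

lemma subdegree_fps_exp_minus_1: "subdegree (fps_exp 1 - 1 :: complex fps) = 1"
  by (intro subdegreeI) auto

lemma fps_exp_minus_1_nonzero: "fps_exp 1 - 1 \<noteq> (0 :: complex fps)"
  using subdegree_fps_exp_minus_1 by auto

lemma bernoulli_base_nth_0: "fps_nth (fps_X / (fps_exp 1 - 1) :: complex fps) 0 = 1"
proof -
  define G where "G = (fps_exp 1 - 1 :: complex fps)"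
  have "subdegree G = 1" "fps_nth G 1 = 1"
    using subdegree_fps_exp_minus_1 by (auto simp: G_def)
  then have "fps_nth (fps_X / G) 0 = 1"
    by (simp add: fps_divide_def)
  then show ?thesis by (simp add: G_def)
qed

lemma euler_base_nth_0: "fps_nth (2 / (fps_exp 1 + 1) :: complex fps) 0 = 1"
  by (simp add: fps_divide_unit)

lemma has_fps_expansion_fps_cpow:
  assumes "f has_fps_expansion F" and "fps_nth F 0 = 1"
  shows "(\<lambda>u. f u powr c) has_fps_expansion fps_cpow F c"
proof -
  have "((\<lambda>x. (1 + x) powr c) \<circ> (\<lambda>u. f u - 1)) has_fps_expansion fps_cpow F c"
    unfolding fps_cpow_def using assms
    by (intro has_fps_expansion_compose fps_expansion_intros) auto
  then show ?thesis by (simp add: o_def)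
qed

lemma has_fps_expansion_imp_eventually_sums:
  assumes "f has_fps_expansion F"
  shows "eventually (\<lambda>u. (\<lambda>n. fps_nth F n * u ^ n) sums f u) (nhds (0 :: complex))"
proof -
  have "eventually (\<lambda>u. u \<in> eball 0 (fps_conv_radius F)) (nhds (0 :: complex))"
    using assms by (intro eventually_nhds_in_open) (auto simp: has_fps_expansion_def zero_ereal_def)
  moreover have "eventually (\<lambda>u. eval_fps F u = f u) (nhds 0)"
    using assms by (simp add: has_fps_expansion_def)
  ultimately show ?thesis
    by eventually_elim (use sums_eval_fps in \<open>fastforce simp: in_eball_iff\<close>)
qed

text \<open>The two generating functions as identities between analytic functions near \<open>u = 0\<close>:\<close>

lemma gen_bernoulli_poly_sums:
  "eventually (\<lambda>u. (\<lambda>n. u ^ n / fact n * poly (gen_bernoulli_poly m n) x) sums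
     ((u / (exp u - 1)) powr m * exp (u * x))) (at 0)"
proof -
  define f where "f = (\<lambda>u::complex. if u = 0 then 1 else u / (exp u - 1))"
  have "f has_fps_expansion (fps_X / (fps_exp 1 - 1))"
    unfolding f_def
    by (intro has_fps_expansion_divide fps_expansion_intros,
        unfold subdegree_fps_exp_minus_1) (auto simp: fps_exp_minus_1_nonzero)
  then have "(\<lambda>u. f u powr m * exp (x * u)) has_fps_expansion
      (fps_cpow (fps_X / (fps_exp 1 - 1)) m * fps_exp x)"
    by (intro has_fps_expansion_mult has_fps_expansion_fps_cpow bernoulli_base_nth_0
        has_fps_expansion_exp)
  from has_fps_expansion_imp_eventually_sums[OF this] show ?thesis
    unfolding eventually_at_filter
    by eventually_elim
       (auto simp: f_def gen_bernoulli_poly_def poly_fps_nth_lift_exp mult.commute[of x]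
          mult.commute[of "_ ^ _"])
qed

lemma gen_euler_poly_sums:
  "eventually (\<lambda>u. (\<lambda>n. u ^ n / fact n * poly (gen_euler_poly l n) x) sums
     ((2 / (exp u + 1)) powr l * exp (u * x))) (nhds 0)"
proof -
  have "(\<lambda>u::complex. 2 / (exp u + 1)) has_fps_expansion (2 / (fps_exp 1 + 1))"
    by (intro fps_expansion_intros) auto
  then have "(\<lambda>u. (2 / (exp u + 1)) powr l * exp (x * u)) has_fps_expansion
      (fps_cpow (2 / (fps_exp 1 + 1)) l * fps_exp x)"
    by (intro has_fps_expansion_mult has_fps_expansion_fps_cpow euler_base_nth_0
        has_fps_expansion_exp)
  from has_fps_expansion_imp_eventually_sums[OF this] show ?thesis
    by eventually_elim
       (simp add: gen_euler_poly_def poly_fps_nth_lift_exp mult.commute[of x]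
          mult.commute[of "_ ^ _"])
qed

end

theory Submission
  imports Defs
begin

text \<open>
  Let \<open>B = u / (e\<^sup>u - 1)\<close> and \<open>E = 2 / (e\<^sup>u + 1)\<close>. A binomial convolution of two sequences is a
  product of their exponential generating functions, and the factor \<open>k\<close> with a shift of the index
  is multiplication by \<open>u\<close>. So the two sides of the theorem are the coefficients of \<open>u\<^sup>n / n!\<close> in
  \<open>B\<^sup>m E\<^bsup>l-1\<^esup> e\<^bsup>u(x+y)\<^esup>\<close> and \<open>(B\<^sup>m + (u/2) B\<^bsup>m-1\<^esup>) E\<^sup>l e\<^bsup>u(x+y)\<^esup>\<close>. Splitting one factor off a power
  (\<open>fps_cpow_diff_one\<close>) turns \<open>E\<^bsup>l-1\<^esup>\<close> into \<open>E\<^sup>l (e\<^sup>u + 1) / 2\<close>. What remains is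
  \<open>(e\<^sup>u + 1) / 2 = 1 + (e\<^sup>u - 1) / 2\<close>, where \<open>(e\<^sup>u - 1) B\<^sup>m = u B\<^bsup>m-1\<^esup>\<close>.
\<close>

lemma fps_binomial_one: "fps_binomial (1 :: complex) = 1 + fps_X"
  using fps_binomial_of_nat[of 1, where ?'a = complex] by simp

text \<open>
  The binomial series is multiplicative in its exponent, and composition with \<open>F - 1\<close> is a ring
  homomorphism because \<open>F - 1\<close> has constant coefficient 0.
\<close>
lemma fps_cpow_diff_one:
  assumes "fps_nth F 0 = 1"
  shows "fps_cpow F (c - 1) * F = fps_cpow F c"
proof -
  have "fps_binomial c = fps_binomial (c - 1) * (1 + fps_X)"
    using fps_binomial_add_mult[of "c - 1" 1] by (simp add: fps_binomial_one)
  then have "fps_cpow F c = fps_cpow F (c - 1) * fps_compose (1 + fps_X) (F - 1)"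
    using assms by (simp add: fps_cpow_def fps_compose_mult_distrib)
  also have "fps_compose (1 + fps_X) (F - 1) = F"
    using assms by (simp add: fps_compose_add_distrib)
  finally show ?thesis ..
qed

lemma bernoulli_base_mult: "fps_X / (fps_exp 1 - 1) * (fps_exp 1 - 1) = (fps_X :: complex fps)"
proof (rule dvd_div_mult_self)
  show "fps_exp 1 - 1 dvd (fps_X :: complex fps)"
    unfolding fps_dvd_iff[OF fps_exp_minus_1_nonzero fps_X_neq_zero] subdegree_fps_exp_minus_1
    by simp
qed

lemma euler_base_mult: "2 / (fps_exp 1 + 1) * (fps_exp 1 + 1) = (2 :: complex fps)"
  by (rule dvd_div_mult_self, rule unit_imp_dvd) simp

lemma poly_gen_bernoulli_poly:
  "poly (gen_bernoulli_poly m k) x =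
     fact k * fps_nth (fps_cpow (fps_X / (fps_exp 1 - 1)) m * fps_exp x) k"
  by (simp add: gen_bernoulli_poly_def poly_fps_nth_lift_exp)

lemma poly_gen_euler_poly:
  "poly (gen_euler_poly l k) y =
     fact k * fps_nth (fps_cpow (2 / (fps_exp 1 + 1)) l * fps_exp y) k"
  by (simp add: gen_euler_poly_def poly_fps_nth_lift_exp)

lemma binomial_convolution_eq_fps_mult:
  fixes F G :: "'a :: field_char_0 fps"
  shows "(\<Sum>k=0..n. of_nat (n choose k) * (fact k * fps_nth F k) * (fact (n - k) * fps_nth G (n - k)))
       = fact n * fps_nth (F * G) n"
  by (simp add: fps_mult_nth sum_distrib_left binomial_fact field_simps)

lemma of_nat_mult_shift_eq_fps_X_mult:
  fixes F :: "'a :: field_char_0 fps"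
  shows "of_nat k * (fact (k - 1) * fps_nth F (k - 1)) = fact k * fps_nth (fps_X * F) k"
  by (cases k) (simp_all add: algebra_simps)

text \<open>
  In terms of \<open>P = B\<^bsup>m-1\<^esup>\<close> and \<open>Q = E\<^bsup>l-1\<^esup>\<close> this reads
  \<open>P B Q = (P B + (u/2) P) Q E\<close>. The only complex powers left are the common factors \<open>P\<close> and
  \<open>Q\<close>, so it follows from the two relations \<open>B (e\<^sup>u - 1) = u\<close> and \<open>E (e\<^sup>u + 1) = 2\<close>.
\<close>
lemma bernoulli_euler_generating_function:
  fixes m l :: complex
  defines "B \<equiv> fps_X / (fps_exp 1 - 1)" and "E \<equiv> 2 / (fps_exp 1 + 1)"
  shows "fps_cpow B m * fps_cpow E (l - 1) =
         (fps_cpow B m + fps_const (1/2) * fps_X * fps_cpow B (m - 1)) * fps_cpow E l"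
proof -
  define e P Q where "e = fps_exp (1 :: complex)" and "P = fps_cpow B (m - 1)"
    and "Q = fps_cpow E (l - 1)"
  have B: "fps_cpow B m = P * B" and E: "fps_cpow E l = Q * E"
    using fps_cpow_diff_one[of B m] fps_cpow_diff_one[of E l] bernoulli_base_nth_0 euler_base_nth_0
    by (simp_all add: P_def Q_def B_def E_def)
  have X: "B * (e - 1) = fps_X" and two: "E * (e + 1) = 2"
    using bernoulli_base_mult euler_base_mult by (simp_all add: B_def E_def e_def)
  have half: "2 * fps_const (1/2 :: complex) = 1"
    by (simp add: numeral_fps_const)
  \<comment> \<open>Writing \<open>u\<close> as \<open>B (e\<^sup>u - 1)\<close> makes the factor \<open>B\<close> common to both summands.\<close>
  have "(P * B + fps_const (1/2) * fps_X * P) * (Q * E)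
      = P * B * Q * E * (1 + fps_const (1/2) * (e - 1))"
    unfolding X[symmetric] by (simp add: algebra_simps)
  also have "1 + fps_const (1/2) * (e - 1) = fps_const (1/2) * (e + 1)"
    using half by algebra
  also have "P * B * Q * E * (fps_const (1/2) * (e + 1)) = P * B * Q * (E * (e + 1)) * fps_const (1/2)"
    by (simp only: ac_simps)
  also have "\<dots> = P * B * Q"
    using half by (simp only: two mult.assoc mult_1_right)
  finally show ?thesis
    unfolding B E Q_def[symmetric] P_def[symmetric] ..
qed

theorem theorem3p3:
  fixes m l x y :: complex and n :: nat
  shows "(\<Sum>k=0..n. of_nat (n choose k) * poly (gen_bernoulli_poly m k) x
            * poly (gen_euler_poly (l - 1) (n - k)) y)
       = (\<Sum>k=0..n. of_nat (n choose k)
            * (poly (gen_bernoulli_poly m k) x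
               + of_nat k / 2 * poly (gen_bernoulli_poly (m - 1) (k - 1)) x)
            * poly (gen_euler_poly l (n - k)) y)"
proof -
  define B :: "complex fps" where "B = fps_X / (fps_exp 1 - 1)"
  define E :: "complex fps" where "E = 2 / (fps_exp 1 + 1)"
  define S where "S = fps_cpow B m + fps_const (1/2) * fps_X * fps_cpow B (m - 1)"
  have bracket: "poly (gen_bernoulli_poly m k) x
      + of_nat k / 2 * poly (gen_bernoulli_poly (m - 1) (k - 1)) x
      = fact k * fps_nth (S * fps_exp x) k" for k
  proof -
    have "S * fps_exp x = fps_cpow B m * fps_exp x
        + fps_const (1/2) * (fps_X * (fps_cpow B (m - 1) * fps_exp x))"
      by (simp only: S_def distrib_right mult.assoc)
    then have "fact k * fps_nth (S * fps_exp x) k = fact k * fps_nth (fps_cpow B m * fps_exp x) k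
        + 1/2 * (fact k * fps_nth (fps_X * (fps_cpow B (m - 1) * fps_exp x)) k)"
      by (simp only: fps_add_nth fps_mult_left_const_nth distrib_left mult.left_commute[of "fact k"])
    then show ?thesis
      using of_nat_mult_shift_eq_fps_X_mult[of k "fps_cpow B (m - 1) * fps_exp x"]
      by (simp only: poly_gen_bernoulli_poly B_def[symmetric]) simp
  qed
  have "fps_cpow B m * fps_exp x * (fps_cpow E (l - 1) * fps_exp y)
      = S * fps_exp x * (fps_cpow E l * fps_exp y)"
    using bernoulli_euler_generating_function[of m l]
    by (simp add: B_def E_def S_def ac_simps)
  then show ?thesis
    unfolding bracket
    by (simp only: poly_gen_bernoulli_poly poly_gen_euler_poly B_def[symmetric]
        E_def[symmetric] binomial_convolution_eq_fps_mult)
qed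

end
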